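(* Let $C_1,\dots,C_n$ be events in a probability space (the minimal cut sets of a system), let $\pi$ be an ordering (permutation) of the index set $\{1,\dots,n\}$, and let $m$ be an integer with $1\le m\le n-2$. Put $P_i=P[C_{\pi(i)}]$ and $P_{ij}=P_{ji}=P[C_{\pi(i)}\cap C_{\pi(j)}]$. Suppose that for every $i$ with $m+1<i\le n$ and every combination of $m+1$ distinct indices $j_1,\dots,j_{m+1}<i$, $$P_{j_r i}\;>\;\sum_{\substack{s=1\\ s\ne r}}^{m+1}\min\big(P_{j_s i},P_{j_r j_s}\big)\qquad\text{for all } r=1,2,\dots,m+1.$$ Then the level $m+1$ bound is less than the level $m$ bound in that ordering: $B_{m+1}(\pi)<B_m(\pi)$.
   Context: With $P_i,P_{ij}$ as in the claim (they depend on $\pi$) and $[x]^+=\max(x,0)$, for $1\le m\le n-1$ the level $m$ second order upper bound (on $P[C_1\cup\dots\cup C_n]$) in the ordering $\pi$ is $$B_m(\pi)=\sum_{i=1}^{n}\Big[P_i-\max_{1\le j_1<j_2<\dots<j_m<i}\Big\{\sum_{r=1}^{m}\Big[P_{j_r i}-\sum_{s=1}^{r-1}\min\big(P_{j_r i},P_{j_s i},P_{j_r j_s}\big)\Big]^+\Big\}\Big].$$ The maximum is over increasing tuples of indices below $i$. In the summands with $i\le m$, where no such $m$-tuple exists, all $i-1$ indices $1<2<\dots<i-1$ are used in place of $m$ indices. Empty sums are $0$, so the subtracted term is $0$ for $i=1$. *)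

theory Defs
  imports "HOL-Probability.Probability"
begin

definition single_prob :: "'a measure \<Rightarrow> (nat \<Rightarrow> 'a set) \<Rightarrow> (nat \<Rightarrow> nat) \<Rightarrow> nat \<Rightarrow> real" where
  "single_prob M C \<pi> i = measure M (C (\<pi> i))"

definition joint_prob :: "'a measure \<Rightarrow> (nat \<Rightarrow> 'a set) \<Rightarrow> (nat \<Rightarrow> nat) \<Rightarrow> nat \<Rightarrow> nat \<Rightarrow> real" where
  "joint_prob M C \<pi> i j = measure M (C (\<pi> i) \<inter> C (\<pi> j))"

text \<open>Tuples \<open>(j\<^sub>1, \<dots>, j\<^sub>k)\<close> are extensional functions on \<open>{1..k}\<close>, so that
  there are only finitely many of them.\<close>

definition increasing_tuples :: "nat \<Rightarrow> nat \<Rightarrow> (nat \<Rightarrow> nat) set" where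
  "increasing_tuples k i = {j \<in> {1..k} \<rightarrow>\<^sub>E {1..<i}. strict_mono_on {1..k} j}"

definition correction ::
  "'a measure \<Rightarrow> (nat \<Rightarrow> 'a set) \<Rightarrow> (nat \<Rightarrow> nat) \<Rightarrow> nat \<Rightarrow> nat \<Rightarrow> (nat \<Rightarrow> nat) \<Rightarrow> real" where
  "correction M C \<pi> i k j =
     (\<Sum>r\<in>{1..k}. max (joint_prob M C \<pi> (j r) i -
        (\<Sum>s\<in>{1..<r}. min (joint_prob M C \<pi> (j r) i)
           (min (joint_prob M C \<pi> (j s) i) (joint_prob M C \<pi> (j r) (j s))))) 0)"

text \<open>For \<open>i \<le> m\<close> there is no increasing \<open>m\<close>-tuple below \<open>i\<close>; the full tuple
  \<open>(1, \<dots>, i - 1)\<close> takes its place.\<close>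

definition second_order_upper_bound ::
  "'a measure \<Rightarrow> (nat \<Rightarrow> 'a set) \<Rightarrow> nat \<Rightarrow> nat \<Rightarrow> (nat \<Rightarrow> nat) \<Rightarrow> real" where
  "second_order_upper_bound M C n m \<pi> =
     (\<Sum>i\<in>{1..n}. single_prob M C \<pi> i -
        (if i \<le> m then correction M C \<pi> i (i - 1) (\<lambda>r. r)
         else Max (correction M C \<pi> i m ` increasing_tuples m i)))"

end

(* Once the order of the tuple is forgotten, the correction term of level k depends only on the
   underlying set T of k indices.  Under the hypothesis every positive part is attained by its
   argument, so on such a set the correction equals the Bonferroni-type expression
   (sum of singles) - (sum over unordered pairs), and adding a further index t raises it by
   a t minus the sum of the weights w t s over s in T, which the hypothesis makes positive.
   So every summand with i > m + 1 strictly decreases, while those with i <= m + 1 agree. *)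
theory Submission
  imports Defs
begin

text \<open>The earlier entries of an increasing tuple are the smaller elements of its image, so the
  order of the indices themselves replaces the positions in the tuple. Keeping \<open>a\<close> and
  \<open>w\<close> abstract frees the combinatorics from probability.\<close>

definition set_correction :: "(nat \<Rightarrow> real) \<Rightarrow> (nat \<Rightarrow> nat \<Rightarrow> real) \<Rightarrow> nat set \<Rightarrow> real" where
  "set_correction a w T = (\<Sum>r\<in>T. max (a r - (\<Sum>s\<in>{s\<in>T. s < r}. w r s)) 0)"

text \<open>Nonnegative weights make each inner sum a part of the full sum over
  \<open>U - {r}\<close>, so no positive part is active. Domination is required on a superset
  \<open>U\<close>, so that one hypothesis serves both a set and its one-point extension.\<close>

lemma set_correction_eq_diff:
  fixes a :: "nat \<Rightarrow> real"
  assumes "finite U" "T \<subseteq> U"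
    and nonneg: "\<And>r s. 0 \<le> w r s"
    and dom: "\<And>r. r \<in> U \<Longrightarrow> (\<Sum>s\<in>U - {r}. w r s) < a r"
  shows "set_correction a w T = (\<Sum>r\<in>T. a r) - (\<Sum>r\<in>T. \<Sum>s\<in>{s\<in>T. s < r}. w r s)"
  unfolding set_correction_def sum_subtractf[symmetric]
proof (rule sum.cong)
  fix r assume "r \<in> T"
  have "(\<Sum>s\<in>{s\<in>T. s < r}. w r s) \<le> (\<Sum>s\<in>U - {r}. w r s)"
    using assms(1,2) nonneg by (intro sum_mono2) auto
  also have "\<dots> < a r"
    using dom \<open>r \<in> T\<close> assms(2) by blast
  finally show "max (a r - (\<Sum>s\<in>{s\<in>T. s < r}. w r s)) 0 = a r - (\<Sum>s\<in>{s\<in>T. s < r}. w r s)"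
    by simp
qed simp

text \<open>The new index \<open>t\<close> is the larger member of its pairs with
  \<open>s < t\<close> and the smaller member of those with \<open>t < r\<close>; by symmetry of
  \<open>w\<close> the two kinds together give the whole sum over \<open>T\<close>.\<close>

lemma sum_pairs_insert:
  fixes w :: "nat \<Rightarrow> nat \<Rightarrow> real"
  assumes "finite T" "t \<notin> T" and sym: "\<And>r s. w r s = w s r"
  shows "(\<Sum>r\<in>insert t T. \<Sum>s\<in>{s\<in>insert t T. s < r}. w r s)
    = (\<Sum>r\<in>T. \<Sum>s\<in>{s\<in>T. s < r}. w r s) + (\<Sum>s\<in>T. w t s)"
proof -
  have split: "(\<Sum>s\<in>{s\<in>insert t T. s < r}. w r s)
      = (\<Sum>s\<in>{s\<in>T. s < r}. w r s) + (if t < r then w t r else 0)" for r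
  proof (cases "t < r")
    case True
    then have "{s\<in>insert t T. s < r} = insert t {s\<in>T. s < r}" by auto
    with True assms(1,2) sym[of r t] show ?thesis by simp
  next
    case False
    then have "{s\<in>insert t T. s < r} = {s\<in>T. s < r}" by auto
    with False show ?thesis by simp
  qed
  have "(\<Sum>s\<in>{s\<in>T. s < t}. w t s) + (\<Sum>r\<in>T. if t < r then w t r else 0) = (\<Sum>s\<in>T. w t s)"
    unfolding sum.inter_filter[OF \<open>finite T\<close>] sum.distrib[symmetric]
    using \<open>t \<notin> T\<close> by (intro sum.cong) auto
  with assms(1,2) show ?thesis
    unfolding split by (simp add: sum.distrib)
qed

text \<open>The gain is \<open>a t\<close> minus the weights from \<open>t\<close> to
  \<open>T\<close>, positive by \<open>dom\<close> at \<open>t\<close>; \<open>dom\<close> at the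
  other indices is what removes the positive parts.\<close>

lemma set_correction_insert_less:
  fixes a :: "nat \<Rightarrow> real"
  assumes "finite T" "t \<notin> T"
    and "\<And>r s. 0 \<le> w r s" and sym: "\<And>r s. w r s = w s r"
    and dom: "\<And>r. r \<in> insert t T \<Longrightarrow> (\<Sum>s\<in>insert t T - {r}. w r s) < a r"
  shows "set_correction a w T < set_correction a w (insert t T)"
proof -
  note eq = set_correction_eq_diff[of "insert t T" _ w a, OF _ _ assms(3) dom]
  have "set_correction a w (insert t T) = set_correction a w T + (a t - (\<Sum>s\<in>T. w t s))"
    using assms(1,2) sum_pairs_insert[of T t w, OF assms(1,2) sym]
    by (simp only: eq[OF _ order_refl] eq[OF _ subset_insertI] finite_insert) simp
  with dom[of t] assms(2) show ?thesis by simp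
qed

lemma set_correction_image_strict_mono:
  fixes j :: "nat \<Rightarrow> nat"
  assumes "strict_mono_on {1..k} j"
  shows "set_correction a w (j ` {1..k})
    = (\<Sum>r\<in>{1..k}. max (a (j r) - (\<Sum>s\<in>{1..<r}. w (j r) (j s))) 0)"
proof -
  have inj: "inj_on j {1..k}"
    using assms by (rule strict_mono_on_imp_inj_on)
  have "{s \<in> j ` {1..k}. s < j r} = j ` {1..<r}" if "r \<in> {1..k}" for r
    using that strict_mono_on_less[OF assms, of _ r] by auto
  moreover have "inj_on j {1..<r}" if "r \<in> {1..k}" for r
    using that by (intro inj_on_subset[OF inj]) auto
  ultimately show ?thesis
    unfolding set_correction_def sum.reindex[OF inj]
    by (intro sum.cong) (simp_all add: sum.reindex)
qed

text \<open>The minimum of all three joint probabilities is symmetric in \<open>r\<close> and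
  \<open>s\<close>, as the pair count requires.\<close>

definition pair_weight ::
  "'a measure \<Rightarrow> (nat \<Rightarrow> 'a set) \<Rightarrow> (nat \<Rightarrow> nat) \<Rightarrow> nat \<Rightarrow> nat \<Rightarrow> nat \<Rightarrow> real" where
  "pair_weight M C \<pi> i r s =
     min (joint_prob M C \<pi> r i) (min (joint_prob M C \<pi> s i) (joint_prob M C \<pi> r s))"

lemma pair_weight_nonneg: "0 \<le> pair_weight M C \<pi> i r s"
  by (simp add: pair_weight_def joint_prob_def)

lemma pair_weight_commute: "pair_weight M C \<pi> i r s = pair_weight M C \<pi> i s r"
  by (simp add: pair_weight_def joint_prob_def Int_commute min.left_commute)

lemma correction_eq_set_correction:
  assumes "strict_mono_on {1..k} j"
  shows "correction M C \<pi> i k j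
    = set_correction (\<lambda>r. joint_prob M C \<pi> r i) (pair_weight M C \<pi> i) (j ` {1..k})"
  unfolding set_correction_image_strict_mono[OF assms]
  by (simp add: correction_def pair_weight_def)

lemma increasing_tuplesD:
  assumes "j \<in> increasing_tuples k i"
  shows "strict_mono_on {1..k} j" "j ` {1..k} \<subseteq> {1..<i}"
  using assms unfolding increasing_tuples_def PiE_def Pi_def by blast+

lemma finite_increasing_tuples: "finite (increasing_tuples k i)"
  unfolding increasing_tuples_def
  by (rule finite_subset[of _ "{1..k} \<rightarrow>\<^sub>E {1..<i}"]) (auto intro: finite_PiE)

lemma obtain_increasing_tuple:
  assumes "T \<subseteq> {1..<i}"
  obtains j where "j \<in> increasing_tuples (card T) i" "j ` {1..card T} = T"
proof -
  have "finite T" using assms finite_subset by blast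
  then obtain h where h: "bij_betw h {0..<card T} T" "strict_mono_on {0..<card T} h"
    unfolding atLeast0LessThan by (rule ex_bij_betw_strict_mono_card)
  \<comment> \<open>The enumeration \<open>h\<close> starts at 0 and tuples start at 1, hence the
    shift; \<open>restrict\<close> makes the tuple extensional.\<close>
  define j where "j = restrict (\<lambda>r. h (r - 1)) {1..card T}"
  have "{1..card T} = Suc ` {0..<card T}"
    by (simp add: atLeastLessThanSuc_atLeastAtMost)
  then have "j ` {1..card T} = h ` {0..<card T}"
    by (force simp: j_def image_image)
  also have "\<dots> = T"
    using h(1) by (rule bij_betw_imp_surj_on)
  finally have img: "j ` {1..card T} = T" .
  have "strict_mono_on {1..card T} j"
    by (intro strict_mono_onI) (auto simp: j_def intro!: strict_mono_onD[OF h(2)])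
  moreover have "j \<in> {1..card T} \<rightarrow>\<^sub>E {1..<i}"
  proof (rule PiE_I)
    show "j r \<in> {1..<i}" if "r \<in> {1..card T}" for r
      using img assms that by blast
  qed (auto simp: j_def)
  ultimately show ?thesis
    using that img by (simp add: increasing_tuples_def)
qed

lemma increasing_tuples_nonempty:
  assumes "k < i"
  shows "increasing_tuples k i \<noteq> {}"
  using obtain_increasing_tuple[of "{1..k}" i] assms by fastforce

lemma strict_mono_on_image_eq_self:
  fixes j :: "nat \<Rightarrow> nat"
  assumes "strict_mono_on {1..k} j" "j ` {1..k} \<subseteq> {1..k}"
  shows "j ` {1..k} = {1..k}"
  using assms strict_mono_on_imp_inj_on endo_inj_surj finite_atLeastAtMost by metis

text \<open>This is the boundary summand \<open>i = m + 1\<close>, where level m takes a maximum and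
  level m + 1 the full tuple. Every competing tuple has image \<open>{1..k}\<close>, so the maximum
  runs over a single value.\<close>

lemma Max_correction_full:
  "Max (correction M C \<pi> (k + 1) k ` increasing_tuples k (k + 1))
    = correction M C \<pi> (k + 1) k (\<lambda>r. r)"
proof -
  have "correction M C \<pi> (k + 1) k j = correction M C \<pi> (k + 1) k (\<lambda>r. r)"
    if "j \<in> increasing_tuples k (k + 1)" for j
  proof -
    have "strict_mono_on {1..k} j" "j ` {1..k} \<subseteq> {1..k}"
      using increasing_tuplesD[OF that] by auto
    moreover have "strict_mono_on {1..k} (\<lambda>r. r)"
      by (simp add: strict_mono_on_def)
    ultimately show ?thesis
      by (simp only: correction_eq_set_correction strict_mono_on_image_eq_self image_ident)
  qed
  then have "correction M C \<pi> (k + 1) k ` increasing_tuples k (k + 1)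
      = {correction M C \<pi> (k + 1) k (\<lambda>r. r)}"
    using increasing_tuples_nonempty[of k "k + 1"] by auto
  then show ?thesis by simp
qed

lemma Max_correction_less:
  assumes "m + 1 < i"
    and dom: "\<And>j r. \<lbrakk>inj_on j {1..m+1}; j ` {1..m+1} \<subseteq> {1..<i}; r \<in> {1..m+1}\<rbrakk> \<Longrightarrow>
      (\<Sum>s\<in>{1..m+1} - {r}. min (joint_prob M C \<pi> (j s) i) (joint_prob M C \<pi> (j r) (j s)))
        < joint_prob M C \<pi> (j r) i"
  shows "Max (correction M C \<pi> i m ` increasing_tuples m i)
    < Max (correction M C \<pi> i (m + 1) ` increasing_tuples (m + 1) i)"
proof -
  define a where "a = (\<lambda>r. joint_prob M C \<pi> r i)"
  define w where "w = pair_weight M C \<pi> i"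
  have "Max (correction M C \<pi> i m ` increasing_tuples m i)
      \<in> correction M C \<pi> i m ` increasing_tuples m i"
    using increasing_tuples_nonempty[of m i] assms(1)
    by (intro Max_in finite_imageI finite_increasing_tuples) auto
  then obtain j where j: "j \<in> increasing_tuples m i"
    and Max_eq: "Max (correction M C \<pi> i m ` increasing_tuples m i) = correction M C \<pi> i m j"
    by blast
  define T where "T = j ` {1..m}"
  have mono: "strict_mono_on {1..m} j" and T: "T \<subseteq> {1..<i}"
    using increasing_tuplesD[OF j] by (simp_all add: T_def)
  have card_T: "card T = m"
    unfolding T_def using strict_mono_on_imp_inj_on[OF mono] by (simp add: card_image)
  have "finite T" by (simp add: T_def)
  \<comment> \<open>There are \<open>i - 1 > m\<close> indices available and \<open>T\<close> has
    only \<open>m\<close>.\<close>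
  have "\<not> {1..<i} \<subseteq> T"
    using card_mono[OF \<open>finite T\<close>, of "{1..<i}"] card_T assms(1) by auto
  then obtain t where t: "t \<in> {1..<i}" "t \<notin> T" by blast
  have card_ins: "card (insert t T) = m + 1"
    using \<open>finite T\<close> t(2) card_T by simp
  obtain j' where j': "j' \<in> increasing_tuples (m + 1) i" and img: "j' ` {1..m+1} = insert t T"
    using obtain_increasing_tuple[of "insert t T" i] T t(1) card_ins
    by (metis insert_subset)
  have mono': "strict_mono_on {1..m+1} j'"
    using j' by (rule increasing_tuplesD)
  then have inj: "inj_on j' {1..m+1}"
    by (rule strict_mono_on_imp_inj_on)
  have "(\<Sum>s\<in>insert t T - {u}. w u s) < a u" if "u \<in> insert t T" for u
  proof -
    obtain r where r: "r \<in> {1..m+1}" "u = j' r"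
      using \<open>u \<in> insert t T\<close> unfolding img[symmetric] by blast
    have img_diff: "insert t T - {u} = j' ` ({1..m+1} - {r})"
      unfolding img[symmetric] r(2)
      using r(1) by (subst inj_on_image_set_diff[OF inj]) auto
    have "(\<Sum>s\<in>insert t T - {u}. w u s) = (\<Sum>s\<in>{1..m+1} - {r}. w (j' r) (j' s))"
      unfolding img_diff unfolding r(2)
      by (subst sum.reindex) (auto intro: inj_on_subset[OF inj])
    \<comment> \<open>The hypothesis bounds sums of twofold minima; the threefold minima in
      \<open>w\<close> are no larger.\<close>
    also have "\<dots> \<le> (\<Sum>s\<in>{1..m+1} - {r}.
        min (joint_prob M C \<pi> (j' s) i) (joint_prob M C \<pi> (j' r) (j' s)))"
      unfolding w_def pair_weight_def by (intro sum_mono min.cobounded2)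
    also have "\<dots> < a u"
      using dom[OF inj _ r(1)] img T t(1) by (simp add: a_def r(2))
    finally show ?thesis .
  qed
  then have "set_correction a w T < set_correction a w (insert t T)"
    unfolding w_def
    by (intro set_correction_insert_less \<open>finite T\<close> t(2) pair_weight_nonneg pair_weight_commute)
  then have "correction M C \<pi> i m j < correction M C \<pi> i (m + 1) j'"
    unfolding correction_eq_set_correction[OF mono] correction_eq_set_correction[OF mono']
      img T_def a_def w_def .
  also have "\<dots> \<le> Max (correction M C \<pi> i (m + 1) ` increasing_tuples (m + 1) i)"
    using j' by (intro Max_ge finite_imageI finite_increasing_tuples) auto
  finally show ?thesis
    using Max_eq by simp
qed

theorem theorem4:
  fixes M :: "'a measure" and C :: "nat \<Rightarrow> 'a set" and \<pi> :: "nat \<Rightarrow> nat" and n m :: nat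
  assumes "prob_space M"
    and "\<And>i. i \<in> {1..n} \<Longrightarrow> C i \<in> sets M"
    and "\<pi> permutes {1..n}"
    and "1 \<le> m" and "m \<le> n - 2"
    and "\<And>i j r. \<lbrakk>m + 1 < i; i \<le> n; inj_on j {1..m+1}; j ` {1..m+1} \<subseteq> {1..<i};
            r \<in> {1..m+1}\<rbrakk> \<Longrightarrow>
          joint_prob M C \<pi> (j r) i >
            (\<Sum>s\<in>{1..m+1} - {r}. min (joint_prob M C \<pi> (j s) i) (joint_prob M C \<pi> (j r) (j s)))"
  shows "second_order_upper_bound M C n (m + 1) \<pi> < second_order_upper_bound M C n m \<pi>"
proof -
  define R where "R = (\<lambda>k i. if i \<le> k then correction M C \<pi> i (i - 1) (\<lambda>r. r)
    else Max (correction M C \<pi> i k ` increasing_tuples k i))"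
  have less: "R m i < R (m + 1) i" if "m + 1 < i" "i \<le> n" for i
    using that Max_correction_less[OF that(1) assms(6)[OF that]] by (simp add: R_def)
  \<comment> \<open>For \<open>i \<le> m\<close> both levels use the full tuple; only
    \<open>i = m + 1\<close> needs an argument.\<close>
  have eq: "R m i = R (m + 1) i" if "i \<le> m + 1" for i
    using that Max_correction_full[of M C \<pi> m] by (cases "i = m + 1") (auto simp: R_def)
  \<comment> \<open>Since \<open>1 \<le> m\<close>, the truncated difference \<open>n - 2\<close> is
    a genuine one. Hence the summand \<open>i = m + 2\<close> exists and supplies the strict
    decrease.\<close>
  have "m + 2 \<le> n"
    using assms(4,5) by simp
  have "(\<Sum>i\<in>{1..n}. single_prob M C \<pi> i - R (m + 1) i)
      < (\<Sum>i\<in>{1..n}. single_prob M C \<pi> i - R m i)"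
  proof (rule sum_strict_mono_ex1)
    show "\<forall>i\<in>{1..n}. single_prob M C \<pi> i - R (m + 1) i \<le> single_prob M C \<pi> i - R m i"
      using less eq by (metis atLeastAtMost_iff diff_left_mono less_eq_real_def not_le)
    show "\<exists>i\<in>{1..n}. single_prob M C \<pi> i - R (m + 1) i < single_prob M C \<pi> i - R m i"
      using less[of "m + 2"] \<open>m + 2 \<le> n\<close> by (intro bexI[of _ "m + 2"]) auto
  qed simp
  then show ?thesis
    by (simp only: second_order_upper_bound_def R_def)
qed

end
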